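(* Let the likelihood be in the exponential family $p(y\mid z)=h(y)\exp(T(y)^\top\phi(z)-A(z))$ with $A(z)=\log\int h(y)\exp(T(y)^\top\phi(z))\,dy$ and $\phi$ one-to-one, and let the prior be $p(z)=s(z\mid\xi_0)$ in the corresponding conjugate family $$s(z\mid\xi)=\exp\!\left(\xi^\top\begin{bmatrix}\phi(z)\\-A(z)\end{bmatrix}-B(\xi)\right),\qquad B(\xi)=\log\int\exp\!\left(\xi^\top\begin{bmatrix}\phi(z)\\-A(z)\end{bmatrix}\right)dz .$$ Let $q_{\mathcal{D}}(z)=s(z\mid\eta)$ be in the conjugate family with parameters $\eta$. Let $\mathcal{D}^*$ be a dataset, let $K\ge1$, let $z_1,\dots,z_K$ be i.i.d. samples from $q_{\mathcal{D}}$, and let $R_K=\frac1K\sum_{k=1}^Kp(\mathcal{D}^*\mid z_k)$. Then $$\mathrm{SNR}(R_K)=\frac{\sqrt K}{\sqrt{\exp(\delta)^2-1}},$$ where $$\delta=\tfrac12\mathrm{KL}\big(s(z\mid\eta+U(\mathcal{D}^* ))\,\|\,s(z\mid\eta)\big)+\tfrac12\mathrm{KL}\big(s(z\mid\eta+U(\mathcal{D}^* ))\,\|\,s(z\mid\eta+U(2\mathcal{D}^* ))\big)$$ $$\phantom{\delta}=\frac{B(\eta)+B(\eta+U(2\mathcal{D}^* ))}{2}-B(\eta+U(\mathcal{D}^* )),$$ and $U(\mathcal{D})=\begin{bmatrix}T(\mathcal{D})\\|\mathcal{D}|\end{bmatrix}$ for any dataset $\mathcal{D}$.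
   Context: Datasets are finite multisets, $2\mathcal{D}^*=\mathcal{D}^*+\mathcal{D}^*$ (multiset addition), $|\mathcal{D}|$ is the number of elements with multiplicity, $T(\mathcal{D})=\sum_{y\in\mathcal{D}}T(y)$ (so $U(2\mathcal{D}^* )=2U(\mathcal{D}^* )$), and $p(\mathcal{D}\mid z)=\prod_{y\in\mathcal{D}}p(y\mid z)$. It is assumed that $B$ is finite at $\eta,\eta+U(\mathcal{D}^* ),\eta+U(2\mathcal{D}^* )$ and that $h(y)>0$ for the data points of $\mathcal{D}^*$. $\mathrm{SNR}(R)=\mathbb{E}[R]/\sqrt{\mathbb{V}[R]}$ ($\mathbb V$ the variance), read as $+\infty$ when $\mathbb{V}[R]=0$ (equivalently $\delta=0$). $\mathrm{KL}(a\|b)=\int a(z)\log\frac{a(z)}{b(z)}\,dz$. *)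

theory Defs
  imports "HOL-Probability.Probability" "HOL-Library.Multiset"
begin

text \<open>
  Densities of observations are taken with respect to a reference measure
  \<open>\<mu>\<close> (Lebesgue, counting, ...), densities of latent variables with respect to a
  reference measure \<open>\<nu>\<close>. A parameter vector of the conjugate family, with its last
  coordinate split off, is an element of the product space \<open>'e \<times> real\<close>, whose inner product
  is \<open>(a, b) \<bullet> (c, d) = a \<bullet> c + b * d\<close>.
\<close>

text \<open>\<open>log (\<integral>f)\<close> is a finite number, for nonnegative \<open>f\<close>.\<close>

definition log_integral_finite :: "'a measure \<Rightarrow> ('a \<Rightarrow> real) \<Rightarrow> bool" where
  "log_integral_finite M f \<longleftrightarrow> integrable M f \<and> 0 < (\<integral>x. f x \<partial>M)"

definition ef_log_partition ::
  "'y measure \<Rightarrow> ('y \<Rightarrow> real) \<Rightarrow> ('y \<Rightarrow> 'e::euclidean_space) \<Rightarrow> ('z \<Rightarrow> 'e) \<Rightarrow> 'z \<Rightarrow> real" where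
  "ef_log_partition \<mu> h T \<phi> z = ln (\<integral>y. h y * exp (T y \<bullet> \<phi> z) \<partial>\<mu>)"

definition ef_likelihood ::
  "'y measure \<Rightarrow> ('y \<Rightarrow> real) \<Rightarrow> ('y \<Rightarrow> 'e::euclidean_space) \<Rightarrow> ('z \<Rightarrow> 'e) \<Rightarrow> 'y \<Rightarrow> 'z \<Rightarrow> real" where
  "ef_likelihood \<mu> h T \<phi> y z = h y * exp (T y \<bullet> \<phi> z - ef_log_partition \<mu> h T \<phi> z)"

definition conj_log_partition ::
  "'z measure \<Rightarrow> ('z \<Rightarrow> 'e::euclidean_space) \<Rightarrow> ('z \<Rightarrow> real) \<Rightarrow> 'e \<times> real \<Rightarrow> real" where
  "conj_log_partition \<nu> \<phi> A \<xi> = ln (\<integral>z. exp (\<xi> \<bullet> (\<phi> z, - A z)) \<partial>\<nu>)"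

definition conj_density ::
  "'z measure \<Rightarrow> ('z \<Rightarrow> 'e::euclidean_space) \<Rightarrow> ('z \<Rightarrow> real) \<Rightarrow> 'e \<times> real \<Rightarrow> 'z \<Rightarrow> real" where
  "conj_density \<nu> \<phi> A \<xi> z = exp (\<xi> \<bullet> (\<phi> z, - A z) - conj_log_partition \<nu> \<phi> A \<xi>)"

definition dataset_likelihood :: "('y \<Rightarrow> 'z \<Rightarrow> real) \<Rightarrow> 'y multiset \<Rightarrow> 'z \<Rightarrow> real" where
  "dataset_likelihood p D z = (\<Prod>y\<in>#D. p y z)"

definition dataset_stat :: "('y \<Rightarrow> 'e::euclidean_space) \<Rightarrow> 'y multiset \<Rightarrow> 'e \<times> real" where
  "dataset_stat T D = (\<Sum>y\<in>#D. T y, real (size D))"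

definition KL :: "'z measure \<Rightarrow> ('z \<Rightarrow> real) \<Rightarrow> ('z \<Rightarrow> real) \<Rightarrow> real" where
  "KL \<nu> a b = (\<integral>z. a z * ln (a z / b z) \<partial>\<nu>)"

text \<open>
  The value for zero variance agrees with division in \<^typ>\<open>ereal\<close>, where
  \<open>a / 0 = \<infinity>\<close> for \<open>a > 0\<close>.
\<close>

definition SNR :: "'w measure \<Rightarrow> ('w \<Rightarrow> real) \<Rightarrow> ereal" where
  "SNR P R =
    (if prob_space.variance P R = 0 then \<infinity>
     else ereal (prob_space.expectation P R / sqrt (prob_space.variance P R)))"

end

theory Submission imports Defs begin

text \<open>
  Up to a positive constant, the likelihood of the dataset is the exponential tilt
  \<open>exp (U D \<bullet> t z)\<close> with \<open>t z = (\<phi> z, - A z)\<close>. Hence its first two moments under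
  the member \<open>\<eta>\<close> of the conjugate family are \<open>exp (B (\<eta> + U D) - B \<eta>)\<close> and
  \<open>exp (B (\<eta> + 2 U D) - B \<eta>)\<close>, up to the constant and its square, and averaging \<open>K\<close>
  independent copies divides the variance by \<open>K\<close>. In the sum of the two
  divergences the terms linear in \<open>t\<close> have opposite signs and cancel.
\<close>

section \<open>Signal-to-noise ratio of a mean of independent copies\<close>

text \<open>After centring, the square of the sum expands into a double sum whose off-diagonal
  expectations factor by independence into products of zero means.\<close>

lemma (in prob_space) variance_sum_indep:
  fixes X :: "'i \<Rightarrow> 'a \<Rightarrow> real"
  assumes fin: "finite I" and indep: "indep_vars (\<lambda>_. borel) X I"
    and int: "\<And>i. i \<in> I \<Longrightarrow> integrable M (X i)"
    and int2: "\<And>i. i \<in> I \<Longrightarrow> integrable M (\<lambda>x. (X i x)\<^sup>2)"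
  shows "variance (\<lambda>x. \<Sum>i\<in>I. X i x) = (\<Sum>i\<in>I. variance (X i))"
proof -
  define Y where "Y i x = X i x - expectation (X i)" for i x
  have indepY: "indep_vars (\<lambda>_. borel) Y I"
    unfolding Y_def by (rule indep_vars_compose2[OF indep]) simp
  have intY: "integrable M (Y i)" if "i \<in> I" for i
    unfolding Y_def using int[OF that] by simp
  have EY: "expectation (Y i) = 0" if "i \<in> I" for i
    unfolding Y_def using int[OF that] by (simp add: prob_space)
  have cross: "integrable M (\<lambda>x. Y i x * Y j x) \<and>
      expectation (\<lambda>x. Y i x * Y j x) = (if j = i then variance (X i) else 0)"
    if ij: "i \<in> I" "j \<in> I" for i j
  proof (cases "i = j")
    case True
    have "integrable M (\<lambda>x. (X i x - expectation (X i))\<^sup>2)"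
      using int[OF ij(1)] int2[OF ij(1)] by (simp add: power2_diff)
    then show ?thesis using True by (simp add: Y_def power2_eq_square)
  next
    case False
    \<comment> \<open>On a two-element index set the product formula for independent variables reads
      E[\<open>Y i\<close> * \<open>Y j\<close>] = E[\<open>Y i\<close>] * E[\<open>Y j\<close>],
      and both factors vanish.\<close>
    have "indep_vars (\<lambda>_. borel) Y {i, j}"
      by (rule indep_vars_subset[OF indepY]) (use ij in auto)
    then show ?thesis
      using indep_vars_lebesgue_integral[of "{i, j}" Y] indep_vars_integrable[of "{i, j}" Y]
        False intY EY ij by auto
  qed
  have "variance (\<lambda>x. \<Sum>i\<in>I. X i x) = expectation (\<lambda>x. (\<Sum>i\<in>I. Y i x)\<^sup>2)"
    using int by (simp add: Y_def sum_subtractf)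
  also have "\<dots> = (\<Sum>i\<in>I. \<Sum>j\<in>I. expectation (\<lambda>x. Y i x * Y j x))"
    using cross by (simp add: power2_eq_square sum_product)
  also have "\<dots> = (\<Sum>i\<in>I. variance (X i))"
    using cross fin by simp
  finally show ?thesis .
qed

text \<open>Writing the variance as \<open>m\<^sup>2 * v\<close> makes \<open>v\<close> the relative
  variance, so the mean \<open>m\<close> cancels from the ratio and any common positive factor of
  the samples drops out. Averaging leaves \<open>m\<close> fixed and divides the variance by
  \<open>K\<close>.\<close>

lemma (in prob_space) SNR_sample_mean:
  fixes X :: "nat \<Rightarrow> 'a \<Rightarrow> real"
  assumes K: "K \<ge> 1" and indep: "indep_vars (\<lambda>_. borel) X {1..K}"
    and int: "\<And>k. k \<in> {1..K} \<Longrightarrow> integrable M (X k)"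
    and int2: "\<And>k. k \<in> {1..K} \<Longrightarrow> integrable M (\<lambda>x. (X k x)\<^sup>2)"
    and mean: "\<And>k. k \<in> {1..K} \<Longrightarrow> expectation (X k) = m"
    and var: "\<And>k. k \<in> {1..K} \<Longrightarrow> variance (X k) = m\<^sup>2 * v"
    and m: "0 < m"
  shows "SNR M (\<lambda>x. 1 / real K * (\<Sum>k=1..K. X k x)) = ereal (sqrt (real K)) / ereal (sqrt v)"
proof -
  define S where "S x = (\<Sum>k=1..K. X k x)" for x
  have ES: "expectation S = real K * m"
    unfolding S_def using int mean by simp
  have VS: "variance S = real K * (m\<^sup>2 * v)"
    unfolding S_def using variance_sum_indep[OF _ indep int int2] var by simp
  have ER: "expectation (\<lambda>x. 1 / real K * S x) = m"
    using ES K by simp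
  have "variance (\<lambda>x. 1 / real K * S x) = variance S / (real K)\<^sup>2"
    unfolding integral_mult_right_zero right_diff_distrib[symmetric] power_mult_distrib
    by (simp add: power_divide)
  then have VR: "variance (\<lambda>x. 1 / real K * S x) = m\<^sup>2 * v / real K"
    using VS K by (simp add: power2_eq_square)
  have "SNR M (\<lambda>x. 1 / real K * S x) = ereal (sqrt (real K)) / ereal (sqrt v)"
  proof (cases "v = 0")
    \<comment> \<open>The quotient is taken in \<open>ereal\<close>, so a positive numerator over
      zero is infinity, matching the convention in \<open>SNR_def\<close>.\<close>
    case True
    then show ?thesis using VR K by (simp add: SNR_def divide_ereal_def zero_ereal_def[symmetric])
  next
    case False
    have "m / sqrt (m\<^sup>2 * v / real K) = sqrt (real K) / sqrt v"
      using m K by (simp add: real_sqrt_mult real_sqrt_divide)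
    then show ?thesis using False VR ER m K by (simp add: SNR_def)
  qed
  then show ?thesis by (simp add: S_def)
qed

section \<open>Divergences inside the conjugate family\<close>

text \<open>With x = \<open>u \<bullet> t z\<close>, the integrand is
  \<open>exp (\<xi> \<bullet> t z)\<close> times \<open>exp x * x\<close>, and the latter is
  dominated by 1 + exp (2x). Finiteness at the outer parameters \<open>\<xi>\<close> and
  \<open>\<xi> + (u + u)\<close> thus controls the linear statistic at their midpoint.\<close>

lemma integrable_exp_tilt_mult_stat:
  fixes \<xi> u :: "'a::euclidean_space" and t :: "'z \<Rightarrow> 'a"
  assumes int0: "integrable M (\<lambda>z. exp (\<xi> \<bullet> t z))"
    and int1: "integrable M (\<lambda>z. exp ((\<xi> + u) \<bullet> t z))"
    and int2: "integrable M (\<lambda>z. exp ((\<xi> + (u + u)) \<bullet> t z))"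
  shows "integrable M (\<lambda>z. exp ((\<xi> + u) \<bullet> t z) * (u \<bullet> t z))"
proof (rule Bochner_Integration.integrable_bound)
  show "integrable M (\<lambda>z. exp (\<xi> \<bullet> t z) + exp ((\<xi> + (u + u)) \<bullet> t z))"
    using int0 int2 by simp
  \<comment> \<open>\<open>t\<close> itself need not be measurable, only its pairing with \<open>u\<close>.\<close>
  have "(\<lambda>z. ln (exp ((\<xi> + u) \<bullet> t z) / exp (\<xi> \<bullet> t z))) \<in> borel_measurable M"
    using borel_measurable_integrable[OF int0] borel_measurable_integrable[OF int1] by measurable
  then have "(\<lambda>z. u \<bullet> t z) \<in> borel_measurable M"
    by (simp add: inner_add_left exp_add)
  then show "(\<lambda>z. exp ((\<xi> + u) \<bullet> t z) * (u \<bullet> t z)) \<in> borel_measurable M"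
    using borel_measurable_integrable[OF int1] by measurable
  \<comment> \<open>Each summand handles one sign: x \<le> exp x gives the bound exp (2x) for
    nonnegative x, and -x \<le> exp (-x) gives the bound 1 for negative x.\<close>
  have bound: "\<bar>exp x * x\<bar> \<le> 1 + exp (x + x)" for x :: real
  proof (cases "0 \<le> x")
    case True
    have "exp x * x \<le> exp x * exp x"
      using exp_ge_add_one_self[of x] by (intro mult_left_mono) (linarith, simp)
    moreover have "\<bar>exp x * x\<bar> = exp x * x" using True by simp
    ultimately show ?thesis unfolding exp_add by linarith
  next
    case False
    have "exp x * (- x) \<le> exp x * exp (- x)"
      using exp_ge_add_one_self[of "- x"] by (intro mult_left_mono) (linarith, simp)
    then have "exp x * (- x) \<le> 1" by (simp add: exp_minus)
    moreover have "\<bar>exp x * x\<bar> = exp x * (- x)" using False by (simp add: abs_mult)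
    ultimately show ?thesis using exp_gt_zero[of "x + x"] by linarith
  qed
  have "exp ((\<xi> + u) \<bullet> t z) * \<bar>u \<bullet> t z\<bar>
      \<le> exp (\<xi> \<bullet> t z) + exp ((\<xi> + (u + u)) \<bullet> t z)" for z
  proof -
    have "exp ((\<xi> + u) \<bullet> t z) * \<bar>u \<bullet> t z\<bar> = exp (\<xi> \<bullet> t z) * \<bar>exp (u \<bullet> t z) * (u \<bullet> t z)\<bar>"
      by (simp add: inner_add_left exp_add abs_mult)
    also have "\<dots> \<le> exp (\<xi> \<bullet> t z) * (1 + exp (u \<bullet> t z + u \<bullet> t z))"
      by (intro mult_left_mono bound) simp
    finally show ?thesis by (simp add: inner_add_left exp_add algebra_simps)
  qed
  then show "AE z in M. norm (exp ((\<xi> + u) \<bullet> t z) * (u \<bullet> t z))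
      \<le> norm (exp (\<xi> \<bullet> t z) + exp ((\<xi> + (u + u)) \<bullet> t z))"
    by (auto simp: abs_mult)
qed

lemma conj_density_eq_divide:
  "conj_density \<nu> \<phi> A \<xi> z
     = exp (\<xi> \<bullet> (\<phi> z, - A z)) / exp (conj_log_partition \<nu> \<phi> A \<xi>)"
  by (simp add: conj_density_def exp_diff)

lemma exp_conj_log_partition:
  assumes "log_integral_finite \<nu> (\<lambda>z. exp (\<xi> \<bullet> (\<phi> z, - A z)))"
  shows "exp (conj_log_partition \<nu> \<phi> A \<xi>) = (\<integral>z. exp (\<xi> \<bullet> (\<phi> z, - A z)) \<partial>\<nu>)"
  using assms by (simp add: conj_log_partition_def log_integral_finite_def)

lemma
  assumes "log_integral_finite \<nu> (\<lambda>z. exp (\<xi> \<bullet> (\<phi> z, - A z)))"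
  shows integrable_conj_density: "integrable \<nu> (conj_density \<nu> \<phi> A \<xi>)"
    and integral_conj_density: "(\<integral>z. conj_density \<nu> \<phi> A \<xi> z \<partial>\<nu>) = 1"
proof -
  have "conj_density \<nu> \<phi> A \<xi>
      = (\<lambda>z. exp (\<xi> \<bullet> (\<phi> z, - A z)) / exp (conj_log_partition \<nu> \<phi> A \<xi>))"
    by (rule ext) (rule conj_density_eq_divide)
  then show "integrable \<nu> (conj_density \<nu> \<phi> A \<xi>)" "(\<integral>z. conj_density \<nu> \<phi> A \<xi> z \<partial>\<nu>) = 1"
    using assms exp_conj_log_partition[OF assms] by (simp_all add: log_integral_finite_def)
qed

text \<open>The log ratio of two members is affine in the statistic, and the first density
  integrates to 1, so the constant part comes out unchanged. The assumption \<open>int\<close>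
  permits splitting the integral; without it the Bochner integral could take its default value
  0.\<close>

lemma KL_conj_density:
  assumes fin: "log_integral_finite \<nu> (\<lambda>z. exp (\<xi> \<bullet> (\<phi> z, - A z)))"
    and int: "integrable \<nu> (\<lambda>z. conj_density \<nu> \<phi> A \<xi> z * ((\<xi> - \<zeta>) \<bullet> (\<phi> z, - A z)))"
  shows "KL \<nu> (conj_density \<nu> \<phi> A \<xi>) (conj_density \<nu> \<phi> A \<zeta>)
    = (\<integral>z. conj_density \<nu> \<phi> A \<xi> z * ((\<xi> - \<zeta>) \<bullet> (\<phi> z, - A z)) \<partial>\<nu>)
      + (conj_log_partition \<nu> \<phi> A \<zeta> - conj_log_partition \<nu> \<phi> A \<xi>)"
proof -
  let ?s = "conj_density \<nu> \<phi> A" and ?B = "conj_log_partition \<nu> \<phi> A"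
  have "ln (?s \<xi> z / ?s \<zeta> z) = (\<xi> - \<zeta>) \<bullet> (\<phi> z, - A z) + (?B \<zeta> - ?B \<xi>)" for z
    unfolding conj_density_def exp_diff[symmetric] ln_exp
    by (simp only: inner_diff_left)
  then have "KL \<nu> (?s \<xi>) (?s \<zeta>)
      = (\<integral>z. ?s \<xi> z * ((\<xi> - \<zeta>) \<bullet> (\<phi> z, - A z)) + ?s \<xi> z * (?B \<zeta> - ?B \<xi>) \<partial>\<nu>)"
    by (simp only: KL_def distrib_left)
  also have "\<dots> = (\<integral>z. ?s \<xi> z * ((\<xi> - \<zeta>) \<bullet> (\<phi> z, - A z)) \<partial>\<nu>) + (?B \<zeta> - ?B \<xi>)"
    using int integrable_conj_density[OF fin] integral_conj_density[OF fin] by simp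
  finally show ?thesis .
qed

text \<open>Both divergences start from the midpoint of \<open>\<xi>\<close> and
  \<open>\<xi> + (u + u)\<close>, so their linear parts are the same integral with opposite signs.
  What remains is the midpoint convexity gap of the log partition function.\<close>

lemma average_KL_conj_density:
  assumes fin: "\<And>\<zeta>. \<zeta> \<in> {\<xi>, \<xi> + u, \<xi> + (u + u)} \<Longrightarrow>
      log_integral_finite \<nu> (\<lambda>z. exp (\<zeta> \<bullet> (\<phi> z, - A z)))"
  shows "1/2 * KL \<nu> (conj_density \<nu> \<phi> A (\<xi> + u)) (conj_density \<nu> \<phi> A \<xi>)
      + 1/2 * KL \<nu> (conj_density \<nu> \<phi> A (\<xi> + u)) (conj_density \<nu> \<phi> A (\<xi> + (u + u)))
    = (conj_log_partition \<nu> \<phi> A \<xi> + conj_log_partition \<nu> \<phi> A (\<xi> + (u + u))) / 2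
      - conj_log_partition \<nu> \<phi> A (\<xi> + u)"
proof -
  let ?t = "\<lambda>z. (\<phi> z, - A z)" and ?s = "conj_density \<nu> \<phi> A"
  have "integrable \<nu> (\<lambda>z. exp ((\<xi> + u) \<bullet> ?t z) * (u \<bullet> ?t z))"
    using fin by (intro integrable_exp_tilt_mult_stat) (auto simp: log_integral_finite_def)
  then have int: "integrable \<nu> (\<lambda>z. ?s (\<xi> + u) z * (u \<bullet> ?t z))"
    unfolding conj_density_eq_divide times_divide_eq_left by (rule integrable_divide)
  have neg: "?s (\<xi> + u) z * ((\<xi> + u - (\<xi> + (u + u))) \<bullet> ?t z)
      = - (?s (\<xi> + u) z * (u \<bullet> ?t z))" for z
  proof -
    have "\<xi> + u - (\<xi> + (u + u)) = - u" by simp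
    then show ?thesis by (simp only: inner_minus_left mult_minus_right)
  qed
  have pos: "\<xi> + u - \<xi> = u" by simp
  have "KL \<nu> (?s (\<xi> + u)) (?s \<xi>) = (\<integral>z. ?s (\<xi> + u) z * (u \<bullet> ?t z) \<partial>\<nu>)
      + (conj_log_partition \<nu> \<phi> A \<xi> - conj_log_partition \<nu> \<phi> A (\<xi> + u))"
    using KL_conj_density[of \<nu> "\<xi> + u" \<phi> A \<xi>] fin int unfolding pos by simp
  moreover have "KL \<nu> (?s (\<xi> + u)) (?s (\<xi> + (u + u)))
      = - (\<integral>z. ?s (\<xi> + u) z * (u \<bullet> ?t z) \<partial>\<nu>)
      + (conj_log_partition \<nu> \<phi> A (\<xi> + (u + u)) - conj_log_partition \<nu> \<phi> A (\<xi> + u))"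
    using KL_conj_density[of \<nu> "\<xi> + u" \<phi> A "\<xi> + (u + u)"] fin int unfolding neg by simp
  ultimately show ?thesis by (simp add: field_simps)
qed

section \<open>Moments of the dataset likelihood\<close>

text \<open>Each data point adds its statistic to the first component of the exponent and one copy
  of -A to the second, which is why the dataset size is the last coordinate of
  \<open>dataset_stat\<close>.\<close>

lemma dataset_likelihood_ef_likelihood:
  "dataset_likelihood (ef_likelihood \<mu> h T \<phi>) D z
    = (\<Prod>y\<in>#D. h y) * exp (dataset_stat T D \<bullet> (\<phi> z, - ef_log_partition \<mu> h T \<phi> z))"
  by (induction D)
    (simp_all add: dataset_likelihood_def dataset_stat_def ef_likelihood_def
      inner_add_left algebra_simps exp_add exp_diff exp_minus)

lemma dataset_stat_union: "dataset_stat T (D + E) = dataset_stat T D + dataset_stat T E"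
  by (simp add: dataset_stat_def)

text \<open>Multiplying the density at \<open>\<xi>\<close> by the tilt gives the unnormalised
  density at \<open>\<xi> + u\<close> over the normaliser at \<open>\<xi>\<close>, so the
  expectation is a ratio of normalisers. It serves for \<open>u\<close> (first moment) and for
  \<open>u + u\<close> (second moment).\<close>

lemma
  fixes u :: "'e::euclidean_space \<times> real"
  assumes distr: "distributed P \<nu> Z (\<lambda>z. ennreal (conj_density \<nu> \<phi> A \<xi> z))"
    and fin0: "integrable \<nu> (\<lambda>z. exp (\<xi> \<bullet> (\<phi> z, - A z)))"
    and fin: "log_integral_finite \<nu> (\<lambda>z. exp ((\<xi> + u) \<bullet> (\<phi> z, - A z)))"
  shows measurable_conj_tilt: "(\<lambda>z. exp (u \<bullet> (\<phi> z, - A z))) \<in> borel_measurable \<nu>"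
    and integrable_conj_tilt: "integrable P (\<lambda>x. exp (u \<bullet> (\<phi> (Z x), - A (Z x))))"
    and expectation_conj_tilt: "(\<integral>x. exp (u \<bullet> (\<phi> (Z x), - A (Z x))) \<partial>P)
      = exp (conj_log_partition \<nu> \<phi> A (\<xi> + u) - conj_log_partition \<nu> \<phi> A \<xi>)"
proof -
  let ?t = "\<lambda>z. (\<phi> z, - A z)" and ?B = "conj_log_partition \<nu> \<phi> A"
  let ?g = "\<lambda>z. exp (u \<bullet> ?t z)"
  have int1: "integrable \<nu> (\<lambda>z. exp ((\<xi> + u) \<bullet> ?t z))"
    using fin by (simp only: log_integral_finite_def)
  \<comment> \<open>The tilt is a quotient of two integrable functions, hence measurable without any
    assumption on \<open>\<phi>\<close> or \<open>A\<close>.\<close>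
  have "(\<lambda>z. exp ((\<xi> + u) \<bullet> ?t z) / exp (\<xi> \<bullet> ?t z)) \<in> borel_measurable \<nu>"
    using borel_measurable_integrable[OF fin0] borel_measurable_integrable[OF int1]
    by (rule borel_measurable_divide[rotated])
  then show meas: "?g \<in> borel_measurable \<nu>"
    by (simp only: inner_add_left exp_add) simp
  have eq: "conj_density \<nu> \<phi> A \<xi> z * ?g z = exp ((\<xi> + u) \<bullet> ?t z) / exp (?B \<xi>)" for z
    by (simp only: conj_density_eq_divide inner_add_left exp_add times_divide_eq_left)
  have nonneg: "0 \<le> conj_density \<nu> \<phi> A \<xi> z" for z
    by (simp add: conj_density_def)
  show "integrable P (\<lambda>x. ?g (Z x))"
    using distributed_integrable[OF distr meas] nonneg int1 unfolding eq by simp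
  show "(\<integral>x. ?g (Z x) \<partial>P) = exp (?B (\<xi> + u) - ?B \<xi>)"
    using distributed_integral[OF distr meas] nonneg exp_conj_log_partition[OF fin]
    unfolding eq by (simp add: exp_diff)
qed

theorem mainTheorem4:
  fixes \<mu> :: "'y measure" and \<nu> :: "'z measure" and P :: "'w measure"
    and h :: "'y \<Rightarrow> real" and T :: "'y \<Rightarrow> 'e::euclidean_space" and \<phi> :: "'z \<Rightarrow> 'e"
    and A :: "'z \<Rightarrow> real" and p :: "'y \<Rightarrow> 'z \<Rightarrow> real"
    and B :: "'e \<times> real \<Rightarrow> real" and s :: "'e \<times> real \<Rightarrow> 'z \<Rightarrow> real"
    and U :: "'y multiset \<Rightarrow> 'e \<times> real"
    and prior q :: "'z \<Rightarrow> real" and \<xi>0 \<eta> :: "'e \<times> real"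
    and Dstar :: "'y multiset" and K :: nat
    and Z :: "nat \<Rightarrow> 'w \<Rightarrow> 'z" and R :: "'w \<Rightarrow> real" and \<delta> :: real
  assumes "sigma_finite_measure \<mu>" and "sigma_finite_measure \<nu>"
    and "h \<in> borel_measurable \<mu>" and "\<And>y. y \<in> space \<mu> \<Longrightarrow> 0 \<le> h y"
    and "T \<in> borel_measurable \<mu>"
    and "\<phi> \<in> borel_measurable \<nu>" and "inj_on \<phi> (space \<nu>)"
    and A_finite: "\<And>z. z \<in> space \<nu> \<Longrightarrow> log_integral_finite \<mu> (\<lambda>y. h y * exp (T y \<bullet> \<phi> z))"
    and A: "A = ef_log_partition \<mu> h T \<phi>"
    and p: "p = ef_likelihood \<mu> h T \<phi>"
    and B: "B = conj_log_partition \<nu> \<phi> A"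
    and s: "s = conj_density \<nu> \<phi> A"
    and U: "U = dataset_stat T"
    and prior: "prior = s \<xi>0"
    and q: "q = s \<eta>"
    and Dstar: "set_mset Dstar \<subseteq> space \<mu>" "\<And>y. y \<in># Dstar \<Longrightarrow> 0 < h y"
    and B_finite: "\<And>\<xi>. \<xi> \<in> {\<xi>0, \<eta>, \<eta> + U Dstar, \<eta> + U (Dstar + Dstar)} \<Longrightarrow>
           log_integral_finite \<nu> (\<lambda>z. exp (\<xi> \<bullet> (\<phi> z, - A z)))"
    and K: "K \<ge> 1"
    and "prob_space P"
    and indep: "prob_space.indep_vars P (\<lambda>_. \<nu>) Z {1..K}"
    and distr: "\<And>k. k \<in> {1..K} \<Longrightarrow> distributed P \<nu> (Z k) (\<lambda>z. ennreal (q z))"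
    and R: "R = (\<lambda>\<omega>. 1 / real K * (\<Sum>k=1..K. dataset_likelihood p Dstar (Z k \<omega>)))"
    and \<delta>: "\<delta> = 1/2 * KL \<nu> (s (\<eta> + U Dstar)) (s \<eta>)
               + 1/2 * KL \<nu> (s (\<eta> + U Dstar)) (s (\<eta> + U (Dstar + Dstar)))"
  shows "SNR P R = ereal (sqrt (real K)) / ereal (sqrt ((exp \<delta>)\<^sup>2 - 1))
       \<and> \<delta> = (B \<eta> + B (\<eta> + U (Dstar + Dstar))) / 2 - B (\<eta> + U Dstar)"
proof -
  interpret P: prob_space P by fact
  let ?t = "\<lambda>z. (\<phi> z, - A z)"
  define c where "c = (\<Prod>y\<in>#Dstar. h y)"
  define u where "u = U Dstar"
  have UU: "U (Dstar + Dstar) = u + u"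
    by (simp only: U u_def dataset_stat_union)
  have fin: "log_integral_finite \<nu> (\<lambda>z. exp (\<xi> \<bullet> ?t z))"
    if "\<xi> \<in> {\<eta>, \<eta> + u, \<eta> + (u + u)}" for \<xi>
    using that B_finite UU u_def by auto
  have \<delta>_eq: "\<delta> = (B \<eta> + B (\<eta> + (u + u))) / 2 - B (\<eta> + u)"
    unfolding \<delta> UU u_def[symmetric] s B by (rule average_KL_conj_density) (rule fin)
  \<comment> \<open>Positivity of \<open>c\<close> makes the mean \<open>m\<close> below positive,
    as dividing it out of the ratio requires.\<close>
  have c: "0 < c"
    unfolding c_def using Dstar(2) by (induction Dstar) auto
  define X where "X k \<omega> = c * exp (u \<bullet> ?t (Z k \<omega>))" for k \<omega>
  have R_eq: "R = (\<lambda>\<omega>. 1 / real K * (\<Sum>k=1..K. X k \<omega>))"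
    unfolding R X_def p c_def u_def U A dataset_likelihood_ef_likelihood ..
  have fin0: "integrable \<nu> (\<lambda>z. exp (\<eta> \<bullet> ?t z))"
    using fin[of \<eta>] by (simp add: log_integral_finite_def)
  note D = distr[unfolded q s]
  note tilt1 = measurable_conj_tilt[OF D fin0 fin[of "\<eta> + u"]]
    integrable_conj_tilt[OF D fin0 fin[of "\<eta> + u"]]
    expectation_conj_tilt[OF D fin0 fin[of "\<eta> + u"]]
  note tilt2 = integrable_conj_tilt[OF D fin0 fin[of "\<eta> + (u + u)"]]
    expectation_conj_tilt[OF D fin0 fin[of "\<eta> + (u + u)"]]
  \<comment> \<open>Squaring doubles the tilt; this is where the doubled dataset enters.\<close>
  have sq: "(X k \<omega>)\<^sup>2 = c\<^sup>2 * exp ((u + u) \<bullet> ?t (Z k \<omega>))" for k \<omega>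
    by (simp only: X_def power_mult_distrib inner_add_left exp_add power2_eq_square mult_ac)
  have int: "integrable P (X k)" if "k \<in> {1..K}" for k
    unfolding X_def using tilt1(2)[OF that] by simp
  have int2: "integrable P (\<lambda>\<omega>. (X k \<omega>)\<^sup>2)" if "k \<in> {1..K}" for k
    unfolding sq using tilt2(1)[OF that] by simp
  define m where "m = c * exp (B (\<eta> + u) - B \<eta>)"
  have mean: "P.expectation (X k) = m" if "k \<in> {1..K}" for k
    unfolding X_def m_def B using tilt1(3)[OF that] by simp
  have mean2: "P.expectation (\<lambda>\<omega>. (X k \<omega>)\<^sup>2) = m\<^sup>2 * (exp \<delta>)\<^sup>2" if "k \<in> {1..K}" for k
  proof -
    have "P.expectation (\<lambda>\<omega>. (X k \<omega>)\<^sup>2) = c\<^sup>2 * exp (B (\<eta> + (u + u)) - B \<eta>)"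
      unfolding sq B using tilt2(2)[OF that] by simp
    \<comment> \<open>This is the formula for \<open>\<delta>\<close> solved for the value of
      \<open>B\<close> at the doubled shift. The first term reproduces the squared mean, so the
      second moment exceeds it by the factor exp (2 \<delta>) and the relative variance is that
      factor minus 1.\<close>
    also have "B (\<eta> + (u + u)) - B \<eta> = 2 * (B (\<eta> + u) - B \<eta>) + 2 * \<delta>"
      unfolding \<delta>_eq by (simp add: field_simps)
    finally show ?thesis
      by (simp add: m_def power_mult_distrib exp_add exp_double[symmetric] right_diff_distrib)
  qed
  have var: "P.variance (X k) = m\<^sup>2 * ((exp \<delta>)\<^sup>2 - 1)" if "k \<in> {1..K}" for k
    using P.variance_eq[OF int[OF that] int2[OF that]] mean[OF that] mean2[OF that]
    by (simp add: algebra_simps)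
  have indepX: "P.indep_vars (\<lambda>_. borel) X {1..K}"
    unfolding X_def
  proof (rule P.indep_vars_compose2[OF indep])
    show "(\<lambda>z. c * exp (u \<bullet> ?t z)) \<in> borel_measurable \<nu>" if "k \<in> {1..K}" for k
      using tilt1(1)[OF that] by simp
  qed
  have "SNR P R = ereal (sqrt (real K)) / ereal (sqrt ((exp \<delta>)\<^sup>2 - 1))"
    unfolding R_eq using c
    by (intro P.SNR_sample_mean[OF K indepX int int2 mean var]) (simp_all add: m_def)
  then show ?thesis using \<delta>_eq unfolding UU u_def by simp
qed

end
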